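(* Let $K$ be a field, $S=K[x_1,\ldots,x_n]$, and let $I\subset S$ be a graded ideal. Then $\mathrm{sat}(I)\leq \mathrm{reg}(I)$.
   Context: $S=K[x_1,\ldots,x_n]$ is the polynomial ring in $n$ variables with graded maximal ideal $\mathfrak{m}=(x_1,\ldots,x_n)$. For a graded ideal $I\subset S$, the saturation number $\mathrm{sat}(I)$ is the smallest integer $k\ge 0$ such that $I:\mathfrak{m}^{k+1}=I:\mathfrak{m}^k$. $\mathrm{reg}(M)$ denotes the Castelnuovo-Mumford regularity of a finitely generated graded $S$-module $M$. *)

theory Defs
  imports "HOL-Library.Poly_Mapping" "HOL-Library.Extended_Real"
begin

text \<open>
  The polynomial ring \<open>S = K[x_1, \<dots>, x_n]\<close> is the monoid algebra of the exponent vectors; the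
  variables are indexed by a finite (hence nonempty) type \<open>'n\<close>, so \<open>n = CARD('n) \<ge> 1\<close>.
\<close>

type_synonym ('n, 'k) mpoly = "('n \<Rightarrow>\<^sub>0 nat) \<Rightarrow>\<^sub>0 'k"

definition var :: "'n::finite \<Rightarrow> ('n, 'k::field) mpoly"
  where "var i = Poly_Mapping.single (Poly_Mapping.single i 1) 1"

definition mon_deg :: "('n::finite \<Rightarrow>\<^sub>0 nat) \<Rightarrow> nat"
  where "mon_deg t = (\<Sum>i\<in>UNIV. Poly_Mapping.lookup t i)"

text \<open>
  Degrees are integers because degree differences of basis elements occur below; the zero
  polynomial is homogeneous of every degree, and the only one of negative degree.
\<close>

definition homogeneous :: "int \<Rightarrow> ('n::finite, 'k::field) mpoly \<Rightarrow> bool"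
  where "homogeneous d f \<longleftrightarrow> (\<forall>t\<in>Poly_Mapping.keys f. int (mon_deg t) = d)"

definition hom_component :: "nat \<Rightarrow> ('n::finite, 'k::field) mpoly \<Rightarrow> ('n, 'k) mpoly"
  where "hom_component d f =
    (\<Sum>t\<in>{t \<in> Poly_Mapping.keys f. mon_deg t = d}. Poly_Mapping.single t (Poly_Mapping.lookup f t))"

text \<open>Ideals are the submodules of a commutative ring, viewed as a module over itself.\<close>

global_interpretation ideal: module "(*) :: 'a::comm_ring_1 \<Rightarrow> 'a \<Rightarrow> 'a"
  by standard (simp_all add: algebra_simps)

definition graded_ideal :: "('n::finite, 'k::field) mpoly set \<Rightarrow> bool"
  where "graded_ideal I \<longleftrightarrow> ideal.subspace I \<and> (\<forall>f\<in>I. \<forall>d. hom_component d f \<in> I)"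

definition max_ideal :: "('n::finite, 'k::field) mpoly set"
  where "max_ideal = ideal.span (range var)"

definition ideal_mult :: "'a::comm_ring_1 set \<Rightarrow> 'a set \<Rightarrow> 'a set"
  where "ideal_mult I J = ideal.span {f * g | f g. f \<in> I \<and> g \<in> J}"

primrec ideal_power :: "'a::comm_ring_1 set \<Rightarrow> nat \<Rightarrow> 'a set"
  where
    "ideal_power I 0 = UNIV"
  | "ideal_power I (Suc k) = ideal_mult I (ideal_power I k)"

definition ideal_colon :: "'a::comm_ring_1 set \<Rightarrow> 'a set \<Rightarrow> 'a set"
  where "ideal_colon I J = {f. \<forall>g\<in>J. f * g \<in> I}"

definition sat_number :: "('n::finite, 'k::field) mpoly set \<Rightarrow> nat"
  where "sat_number I =
    (LEAST k. ideal_colon I (ideal_power max_ideal (k + 1)) = ideal_colon I (ideal_power max_ideal k))"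

text \<open>
  Data of a sequence \<open>\<dots> \<rightarrow> F_2 \<rightarrow> F_1 \<rightarrow> F_0 \<rightarrow> I\<close> of graded free modules of finite rank: \<open>F_i\<close> has
  the basis elements \<open>e_{i,k}\<close>, \<open>k < rank F i\<close>, of degree \<open>shift F i k\<close>, that is, \<open>F_i\<close> is the
  direct sum of the modules \<open>S(- shift F i k)\<close>.  The map \<open>F_0 \<rightarrow> I\<close> sends \<open>e_{0,k}\<close> to \<open>aug F k\<close>, and
  \<open>F_{i+1} \<rightarrow> F_i\<close> sends \<open>e_{i+1,l}\<close> to the sum of the \<open>mat F i k l * e_{i,k}\<close> over \<open>k < rank F i\<close>.
  Elements of \<open>F_i\<close> are coefficient vectors \<open>v :: nat \<Rightarrow> S\<close>, of which only the entries \<open>v k\<close> with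
  \<open>k < rank F i\<close> matter.
\<close>

record (overloaded) ('n, 'k) free_complex =
  rank :: "nat \<Rightarrow> nat"
  shift :: "nat \<Rightarrow> nat \<Rightarrow> int"
  aug :: "nat \<Rightarrow> ('n, 'k) mpoly"
  mat :: "nat \<Rightarrow> nat \<Rightarrow> nat \<Rightarrow> ('n, 'k) mpoly"

definition aug_map :: "('n::finite, 'k::field) free_complex \<Rightarrow> (nat \<Rightarrow> ('n, 'k) mpoly) \<Rightarrow> ('n, 'k) mpoly"
  where "aug_map F v = (\<Sum>k<rank F 0. v k * aug F k)"

definition diff_map ::
    "('n::finite, 'k::field) free_complex \<Rightarrow> nat \<Rightarrow> (nat \<Rightarrow> ('n, 'k) mpoly) \<Rightarrow> nat \<Rightarrow> ('n, 'k) mpoly"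
  where "diff_map F i v k = (\<Sum>l<rank F (Suc i). mat F i k l * v l)"

definition graded_free_resolution ::
    "('n::finite, 'k::field) mpoly set \<Rightarrow> ('n, 'k) free_complex \<Rightarrow> bool"
  where "graded_free_resolution I F \<longleftrightarrow>
    (\<forall>k<rank F 0. homogeneous (shift F 0 k) (aug F k)) \<and>
    (\<forall>i. \<forall>k<rank F i. \<forall>l<rank F (Suc i).
        homogeneous (shift F (Suc i) l - shift F i k) (mat F i k l)) \<and>
    range (aug_map F) = I \<and>
    (\<forall>v. aug_map F v = 0 \<longleftrightarrow> (\<exists>w. \<forall>k<rank F 0. v k = diff_map F 0 w k)) \<and>
    (\<forall>i v. (\<forall>k<rank F i. diff_map F i v k = 0) \<longleftrightarrow>
        (\<exists>w. \<forall>l<rank F (Suc i). v l = diff_map F (Suc i) w l))"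

definition minimal_graded_free_resolution ::
    "('n::finite, 'k::field) mpoly set \<Rightarrow> ('n, 'k) free_complex \<Rightarrow> bool"
  where "minimal_graded_free_resolution I F \<longleftrightarrow>
    graded_free_resolution I F \<and>
    (\<forall>i. \<forall>k<rank F i. \<forall>l<rank F (Suc i). mat F i k l \<in> max_ideal)"

text \<open>
  The exponent of \<open>S(-j)\<close> in \<open>F_i\<close>.  For a minimal graded free resolution of \<open>I\<close> this is the
  graded Betti number \<open>\<beta>_{i,j}(I)\<close>, the dimension of \<open>Tor_i(I, K)_j\<close>.
\<close>

definition betti :: "('n::finite, 'k::field) free_complex \<Rightarrow> nat \<Rightarrow> int \<Rightarrow> nat"
  where "betti F i j = card {k. k < rank F i \<and> shift F i k = j}"

text \<open>
  \<open>reg(I) = max {j - i | \<beta>_{i,j}(I) \<noteq> 0}\<close>.  A minimal graded free resolution of \<open>I\<close> exists and is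
  unique up to isomorphism, so the outer infimum is over a single value, and it merely selects
  that value.  The inner supremum is a maximum, by Hilbert's syzygy theorem.  Extended reals are
  used so that the definition does not depend on these theorems.

  For the zero ideal there is no nonzero Betti number; we use the convention \<open>reg(0) = 0\<close>.
\<close>

definition regularity :: "('n::finite, 'k::field) mpoly set \<Rightarrow> ereal"
  where "regularity I =
    (if I = {0} then 0
     else INF F\<in>{F. minimal_graded_free_resolution I F}.
            SUP (i, j)\<in>{(i, j). betti F i j \<noteq> 0}. ereal (real_of_int (j - int i)))"

end

theory Submission
  imports Defs
begin

text \<open>
  Let \<open>r = reg(I)\<close>.  It is enough that a form \<open>f\<close> of degree \<open>d \<ge> r\<close> with \<open>\<mm> f \<subseteq> I\<close> lies in \<open>I\<close>:
  if \<open>\<mm>^(r+1) f \<subseteq> I\<close> and \<open>h \<in> \<mm>^r\<close>, then \<open>\<mm> f h \<subseteq> I\<close>, and all homogeneous components of \<open>f h\<close>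
  have degree at least \<open>r\<close>, so \<open>f h \<in> I\<close>.

  The socle of \<open>S/I\<close> in degree \<open>d\<close> is \<open>Tor_n(S/I, K) = Tor_(n-1)(I, K)\<close> in degree \<open>d + n\<close>, which
  vanishes because \<open>F_(n-1)\<close> is generated in degrees at most \<open>r + n - 1 < d + n\<close>.  Concretely, the
  multiple \<open>f\<close> of the top Koszul basis element is chased through the double complex of the
  resolution and the Koszul complex of the variables, down to \<open>F_(n-1)\<close> and back.
\<close>

section \<open>Graded polynomials\<close>

lemma mon_deg_add: "mon_deg (s + t) = mon_deg s + mon_deg t"
  by (simp add: mon_deg_def lookup_add sum.distrib)

lemma mon_deg_single: "mon_deg (Poly_Mapping.single i a) = a"
  by (simp add: mon_deg_def lookup_single when_def)

lemma homogeneous_0 [simp]: "homogeneous d 0"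
  by (simp add: homogeneous_def)

lemma homogeneous_uminus: "homogeneous d f \<Longrightarrow> homogeneous d (- f)"
  by (simp add: homogeneous_def in_keys_iff)

lemma homogeneous_add:
  assumes "homogeneous d f" "homogeneous d g"
  shows "homogeneous d (f + g)"
  using assms Poly_Mapping.keys_add[of f g] unfolding homogeneous_def by blast

lemma homogeneous_mult:
  assumes "homogeneous d f" "homogeneous e g"
  shows "homogeneous (d + e) (f * g)"
  unfolding homogeneous_def
proof
  fix t assume "t \<in> Poly_Mapping.keys (f * g)"
  then obtain u v where "u \<in> Poly_Mapping.keys f" "v \<in> Poly_Mapping.keys g" "t = u + v"
    using keys_mult[of f g] by blast
  then show "int (mon_deg t) = d + e"
    using assms by (simp add: homogeneous_def mon_deg_add)
qed

lemma homogeneous_var: "homogeneous 1 (var i)"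
  by (simp add: homogeneous_def var_def mon_deg_single)

lemma homogeneous_nonneg: "homogeneous d f \<Longrightarrow> f \<noteq> 0 \<Longrightarrow> 0 \<le> d"
  unfolding homogeneous_def by (metis keys_eq_empty ex_in_conv of_nat_0_le_iff)

text \<open>Integer degrees allow differences such as \<open>e - shift F i k\<close> without side
  conditions.\<close>

definition component :: "int \<Rightarrow> ('n::finite, 'k::field) mpoly \<Rightarrow> ('n, 'k) mpoly"
  where "component d f = (if d < 0 then 0 else hom_component (nat d) f)"

lemma lookup_component:
  "Poly_Mapping.lookup (component d f) t = (if int (mon_deg t) = d then Poly_Mapping.lookup f t else 0)"
proof (cases "d < 0")
  case False
  have "Poly_Mapping.lookup (component d f) t =
      (\<Sum>u\<in>{u \<in> Poly_Mapping.keys f. mon_deg u = nat d}. if u = t then Poly_Mapping.lookup f u else 0)"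
    using False by (simp add: component_def hom_component_def lookup_sum lookup_single when_def)
  also have "\<dots> = (if int (mon_deg t) = d then Poly_Mapping.lookup f t else 0)"
    using False by (auto simp: in_keys_iff)
  finally show ?thesis .
qed (simp add: component_def)

lemma homogeneous_component: "homogeneous d (component d f)"
  by (auto simp: homogeneous_def in_keys_iff lookup_component split: if_splits)

lemma component_homogeneous:
  "homogeneous e f \<Longrightarrow> component d f = (if d = e then f else 0)"
  by (rule poly_mapping_eqI) (auto simp: lookup_component homogeneous_def in_keys_iff)

lemma component_add: "component d (f + g) = component d f + component d g"
  by (rule poly_mapping_eqI) (simp add: lookup_component lookup_add)

lemma component_0 [simp]: "component d 0 = 0"
  by (rule poly_mapping_eqI) (simp add: lookup_component)

lemma component_sum: "component d (sum f A) = (\<Sum>a\<in>A. component d (f a))"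
  by (induction A rule: infinite_finite_induct) (simp_all add: component_add)

lemma sum_components: "f = (\<Sum>d\<in>(\<lambda>t. int (mon_deg t)) ` Poly_Mapping.keys f. component d f)"
proof (rule poly_mapping_eqI)
  fix t
  show "Poly_Mapping.lookup f t = Poly_Mapping.lookup
    (\<Sum>d\<in>(\<lambda>t. int (mon_deg t)) ` Poly_Mapping.keys f. component d f) t"
    by (auto simp: lookup_sum lookup_component in_keys_iff)
qed

lemma component_eq_0:
  "d \<notin> (\<lambda>t. int (mon_deg t)) ` Poly_Mapping.keys f \<Longrightarrow> component d f = 0"
  by (rule poly_mapping_eqI) (auto simp: lookup_component in_keys_iff)

text \<open>Each \<open>component j f * g\<close> is homogeneous of degree \<open>j + e\<close>, so
  only \<open>j = d - e\<close> contributes.\<close>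

lemma component_mult_right:
  assumes g: "homogeneous e g"
  shows "component d (f * g) = component (d - e) f * g"
proof -
  let ?J = "(\<lambda>t. int (mon_deg t)) ` Poly_Mapping.keys f"
  have "component d (f * g) = component d ((\<Sum>j\<in>?J. component j f) * g)"
    using sum_components[of f] by simp
  also have "\<dots> = (\<Sum>j\<in>?J. component d (component j f * g))"
    by (simp only: sum_distrib_right component_sum)
  also have "\<dots> = (\<Sum>j\<in>?J. if j = d - e then component j f * g else 0)"
    by (intro sum.cong refl)
      (auto simp: component_homogeneous[OF homogeneous_mult[OF homogeneous_component g]])
  also have "\<dots> = component (d - e) f * g"
    using component_eq_0[of "d - e" f] by (subst sum.delta) auto
  finally show ?thesis .
qed

lemma component_mult_left:
  "homogeneous e g \<Longrightarrow> component d (g * f) = g * component (d - e) f"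
  using component_mult_right[of e g d f] by (simp add: mult.commute)

lemma component_in_graded_ideal: "graded_ideal I \<Longrightarrow> f \<in> I \<Longrightarrow> component d f \<in> I"
  by (simp add: graded_ideal_def component_def ideal.subspace_0)

section \<open>Ideals generated by variables\<close>

lemma single_var_mult:
  assumes "Poly_Mapping.lookup t i \<noteq> 0"
  shows "Poly_Mapping.single t c =
    Poly_Mapping.single (t - Poly_Mapping.single i 1) c * var i"
proof -
  have "t = t - Poly_Mapping.single i 1 + Poly_Mapping.single i 1"
    by (rule poly_mapping_eqI)
      (use assms in \<open>auto simp: lookup_add lookup_minus lookup_single when_def\<close>)
  then show ?thesis
    by (simp add: var_def mult_single)
qed

lemma sum_monomials:
  "f = (\<Sum>t\<in>Poly_Mapping.keys f. Poly_Mapping.single t (Poly_Mapping.lookup f t))"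
  by (rule poly_mapping_eqI) (auto simp: lookup_sum lookup_single when_def in_keys_iff)

text \<open>Translation of exponent vectors is injective, so no two monomials of the product collide
  and nothing cancels.\<close>

lemma keys_mult_var:
  "Poly_Mapping.keys (f * var i) = (\<lambda>t. t + Poly_Mapping.single i 1) ` Poly_Mapping.keys f"
proof -
  let ?x = "Poly_Mapping.single i (1::nat)"
  have "f * var i = (\<Sum>t\<in>Poly_Mapping.keys f. Poly_Mapping.single (t + ?x) (Poly_Mapping.lookup f t))"
    by (subst (1) sum_monomials[of f]) (simp add: sum_distrib_right var_def mult_single)
  then have *: "Poly_Mapping.lookup (f * var i) u =
      (\<Sum>t\<in>Poly_Mapping.keys f. if t + ?x = u then Poly_Mapping.lookup f t else 0)" for u
    by (simp add: lookup_sum lookup_single when_def)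
  have shift: "Poly_Mapping.lookup (f * var i) (t + ?x) = Poly_Mapping.lookup f t" for t
    by (simp add: * in_keys_iff)
  have other: "Poly_Mapping.lookup (f * var i) u = 0" if "u \<notin> range (\<lambda>t. t + ?x)" for u
    unfolding * using that by (intro sum.neutral) auto
  show ?thesis
  proof (rule set_eqI)
    fix u
    show "u \<in> Poly_Mapping.keys (f * var i) \<longleftrightarrow> u \<in> (\<lambda>t. t + ?x) ` Poly_Mapping.keys f"
    proof (cases "u \<in> range (\<lambda>t. t + ?x)")
      case True
      then obtain t where "u = t + ?x"
        by blast
      then show ?thesis
        using shift[of t] by (auto simp: in_keys_iff)
    next
      case False
      then show ?thesis
        using other[of u] by (auto simp: in_keys_iff)
    qed
  qed
qed

text \<open>Exponents add, so the support condition survives sums and multiples; conversely, a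
  monomial divisible by a variable is a multiple of it.\<close>

lemma span_vars:
  "ideal.span (var ` A) = {f. \<forall>t\<in>Poly_Mapping.keys f. \<exists>i\<in>A. Poly_Mapping.lookup t i \<noteq> 0}"
    (is "_ = ?D")
proof
  have "ideal.subspace ?D"
  proof (rule ideal.subspaceI)
    fix f g :: "('a, 'b) mpoly"
    show "f + g \<in> ?D" if "f \<in> ?D" "g \<in> ?D"
      using that Poly_Mapping.keys_add[of f g] by blast
    show "f * g \<in> ?D" if "g \<in> ?D"
    proof safe
      fix t assume "t \<in> Poly_Mapping.keys (f * g)"
      then obtain u v where "t = u + v" "v \<in> Poly_Mapping.keys g"
        using keys_mult[of f g] by blast
      then show "\<exists>i\<in>A. Poly_Mapping.lookup t i \<noteq> 0"
        using that by (auto simp: lookup_add)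
    qed
  qed simp
  moreover have "var ` A \<subseteq> ?D"
    by (auto simp: var_def lookup_single when_def)
  ultimately show "ideal.span (var ` A) \<subseteq> ?D"
    by (rule ideal.span_minimal[rotated])
next
  show "?D \<subseteq> ideal.span (var ` A)"
  proof
    fix f assume f: "f \<in> ?D"
    have "(\<Sum>t\<in>Poly_Mapping.keys f. Poly_Mapping.single t (Poly_Mapping.lookup f t)) \<in> ideal.span (var ` A)"
    proof (rule ideal.span_sum)
      fix t assume "t \<in> Poly_Mapping.keys f"
      then obtain i where "i \<in> A" "Poly_Mapping.lookup t i \<noteq> 0"
        using f by auto
      then show "Poly_Mapping.single t (Poly_Mapping.lookup f t) \<in> ideal.span (var ` A)"
        by (auto simp: single_var_mult[of t i] intro: ideal.span_scale ideal.span_base)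
    qed
    then show "f \<in> ideal.span (var ` A)"
      using sum_monomials[of f] by simp
  qed
qed

text \<open>Multiplication by \<open>var i\<close> changes only the exponent at \<open>i\<close>,
  which lies outside \<open>A\<close>, so it does not affect divisibility by the variables from
  \<open>A\<close>.\<close>

lemma var_regular:
  assumes "i \<notin> A" "var i * f \<in> ideal.span (var ` A)"
  shows "f \<in> ideal.span (var ` A)"
proof -
  have "\<exists>j\<in>A. Poly_Mapping.lookup t j \<noteq> 0" if "t \<in> Poly_Mapping.keys f" for t
  proof -
    have "t + Poly_Mapping.single i 1 \<in> Poly_Mapping.keys (var i * f)"
      using that by (simp add: mult.commute[of _ f] keys_mult_var)
    then obtain j where "j \<in> A" "Poly_Mapping.lookup (t + Poly_Mapping.single i 1) j \<noteq> 0"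
      using assms(2) unfolding span_vars by blast
    then show ?thesis
      using assms(1) by (auto simp: lookup_add lookup_single when_def split: if_splits)
  qed
  then show ?thesis
    by (simp add: span_vars)
qed

text \<open>The case \<open>A = {}\<close> of \<open>var_regular\<close>, where the span is the zero
  ideal.\<close>

lemma var_mult_cancel:
  assumes "var i * f = var i * g"
  shows "f = g"
proof -
  have "var i * (f - g) \<in> ideal.span (var ` {})"
    using assms by (simp add: right_diff_distrib)
  then show ?thesis
    using var_regular[of i "{}" "f - g"] by simp
qed

lemma homogeneous_pos_in_max_ideal:
  assumes "homogeneous d f" "0 < d"
  shows "f \<in> max_ideal"
proof -
  have "\<exists>i. Poly_Mapping.lookup t i \<noteq> 0" if "t \<in> Poly_Mapping.keys f" for t
  proof -
    have "mon_deg t \<noteq> 0"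
      using that assms by (auto simp: homogeneous_def)
    then show ?thesis
      by (auto simp: mon_deg_def)
  qed
  then show ?thesis
    by (simp add: max_ideal_def span_vars)
qed

section \<open>The Koszul complex\<close>

text \<open>
  A basis element of the Koszul complex of \<open>x_1, \<dots>, x_n\<close> is encoded by the list of length \<open>n\<close> whose
  \<open>i\<close>-th entry tells whether \<open>e_i\<close> occurs in it.  An element of the complex, of mixed homological
  degree, is its coefficient function.  The recursion is the mapping cone construction.
\<close>

fun koszul :: "'a::comm_ring_1 list \<Rightarrow> (bool list \<Rightarrow> 'a) \<Rightarrow> bool list \<Rightarrow> 'a" where
  "koszul (x # xs) a (True # bs) = - koszul xs (\<lambda>c. a (True # c)) bs"
| "koszul (x # xs) a (False # bs) = koszul xs (\<lambda>c. a (False # c)) bs + x * a (True # bs)"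
| "koszul _ _ _ = 0"

text \<open>The homological degree of the encoded basis element.\<close>

definition weight :: "bool list \<Rightarrow> nat"
  where "weight bs = length (filter id bs)"

lemma weight_simps [simp]:
  "weight [] = 0" "weight (True # bs) = Suc (weight bs)" "weight (False # bs) = weight bs"
  by (simp_all add: weight_def)

lemma weight_le: "weight bs \<le> length bs"
  by (simp add: weight_def)

lemma weight_replicate: "weight (replicate n False) = 0" "weight (replicate n True) = n"
  by (induction n) simp_all

lemma koszul_add: "koszul xs (\<lambda>c. a c + b c) bs = koszul xs a bs + koszul xs b bs"
proof (induction xs a bs arbitrary: b rule: koszul.induct)
  case (1 x xs a bs)
  show ?case
    unfolding koszul.simps 1 by simp
next
  case (2 x xs a bs)
  show ?case
    unfolding koszul.simps 2 by (simp add: algebra_simps)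
qed simp_all

lemma koszul_mult: "koszul xs (\<lambda>c. r * a c) bs = r * koszul xs a bs"
proof (induction xs a bs rule: koszul.induct)
  case (1 x xs a bs)
  show ?case
    by (simp only: koszul.simps 1 mult_minus_right)
next
  case (2 x xs a bs)
  show ?case
    by (simp only: koszul.simps 2 distrib_left mult.left_commute)
qed (simp_all only: koszul.simps mult_zero_right)

lemma koszul_diff: "koszul xs (\<lambda>c. a c - b c) bs = koszul xs a bs - koszul xs b bs"
  using koszul_add[of xs "\<lambda>c. a c - b c" b bs] by simp

lemma koszul_zero: "koszul xs (\<lambda>c. 0) bs = 0"
  using koszul_mult[of xs 0 "\<lambda>c. 0" bs] by simp

lemma koszul_sum: "koszul xs (\<lambda>c. \<Sum>l\<in>L. a l c) bs = (\<Sum>l\<in>L. koszul xs (a l) bs)"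
  by (induction L rule: infinite_finite_induct) (simp_all add: koszul_add koszul_zero)

text \<open>The differential at weight \<open>w\<close> is a signed sum of entries of
  \<open>xs\<close> times coefficients of weight \<open>w + 1\<close>. Suitable families
  \<open>G\<close> and \<open>H\<close> turn this into facts on vanishing, membership and
  degree.\<close>

lemma koszul_in:
  assumes "\<And>bs. length bs = length xs \<Longrightarrow> a bs \<in> G (weight bs)"
    and "\<And>x w f. x \<in> set xs \<Longrightarrow> f \<in> G (Suc w) \<Longrightarrow> x * f \<in> H w"
    and "\<And>w. 0 \<in> H w"
    and "\<And>w f. f \<in> H w \<Longrightarrow> - f \<in> H w"
    and "\<And>w f g. f \<in> H w \<Longrightarrow> g \<in> H w \<Longrightarrow> f + g \<in> H w"
    and "length bs = length xs"
  shows "koszul xs a bs \<in> H (weight bs)"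
  using assms
proof (induction xs a bs arbitrary: G H rule: koszul.induct)
  case (1 x xs a bs)
  have "koszul xs (\<lambda>c. a (True # c)) bs \<in> H (Suc (weight bs))"
  \<comment> \<open>Dropping the leading \<open>True\<close> lowers the weight by one, hence the
    shifted families.\<close>
  proof (rule "1.IH"[where G = "\<lambda>w. G (Suc w)" and H = "\<lambda>w. H (Suc w)"])
    fix bs' :: "bool list" assume "length bs' = length xs"
    then show "a (True # bs') \<in> G (Suc (weight bs'))"
      using "1.prems"(1)[of "True # bs'"] by simp
  qed (use "1.prems" in auto)
  then show ?case
    using "1.prems"(4) by simp
next
  case (2 x xs a bs)
  have "koszul xs (\<lambda>c. a (False # c)) bs \<in> H (weight bs)"
  proof (rule "2.IH"[where G = G and H = H])
    fix bs' :: "bool list" assume "length bs' = length xs"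
    then show "a (False # bs') \<in> G (weight bs')"
      using "2.prems"(1)[of "False # bs'"] by simp
  qed (use "2.prems" in auto)
  moreover have "x * a (True # bs) \<in> H (weight bs)"
    using "2.prems"(1)[of "True # bs"] "2.prems"(6) by (intro "2.prems"(2)) auto
  ultimately show ?case
    using "2.prems"(5) by simp
qed auto

text \<open>The differential never reads coefficients of weight 0, hence the choice of
  \<open>UNIV\<close> for that weight.\<close>

lemma koszul_cong:
  assumes "\<And>bs. length bs = length xs \<Longrightarrow> weight bs \<noteq> 0 \<Longrightarrow> a bs = b bs" "length bs = length xs"
  shows "koszul xs a bs = koszul xs b bs"
proof -
  have "koszul xs (\<lambda>c. a c - b c) bs \<in> (\<lambda>w::nat. {0}) (weight bs)"
    by (rule koszul_in[where G = "\<lambda>w. if w = 0 then UNIV else {0}"]) (use assms in auto)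
  then show ?thesis
    by (simp add: koszul_diff)
qed

lemma koszul_in_span:
  assumes "length bs = length xs"
  shows "koszul xs a bs \<in> ideal.span (set xs)"
proof (rule koszul_in[where G = "\<lambda>_. UNIV" and H = "\<lambda>_. ideal.span (set xs)"])
  fix x f assume "x \<in> set xs"
  then show "x * f \<in> ideal.span (set xs)"
    using ideal.span_scale[OF ideal.span_base, of x "set xs" f] by (simp add: mult.commute)
qed (simp_all add: assms ideal.span_add ideal.span_neg ideal.span_zero)

text \<open>The mixed terms \<open>x * koszul xs (\<lambda>c. a (True # c)) bs\<close> cancel thanks
  to the sign in the first clause of \<open>koszul\<close>.\<close>

lemma koszul_koszul: "koszul xs (koszul xs a) bs = 0"
proof (induction xs a bs rule: koszul.induct)
  case (1 x xs a bs)
  have "koszul xs (\<lambda>c. - koszul xs (\<lambda>c. a (True # c)) c) bs =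
      koszul xs (\<lambda>c. (- 1) * koszul xs (\<lambda>c. a (True # c)) c) bs"
    by simp
  also have "\<dots> = 0"
    by (simp only: koszul_mult) (simp add: 1)
  finally show ?case
    by simp
next
  case (2 x xs a bs)
  then show ?case
    by (simp add: koszul_add koszul_mult)
qed simp_all

text \<open>Regularity is asked modulo the later entries because \<open>koszul\<close> removes
  entries from the front.\<close>

primrec regular_sequence :: "'a::comm_ring_1 list \<Rightarrow> bool" where
  "regular_sequence [] \<longleftrightarrow> True"
| "regular_sequence (x # xs) \<longleftrightarrow>
    (\<forall>f. x * f \<in> ideal.span (set xs) \<longrightarrow> f \<in> ideal.span (set xs)) \<and> regular_sequence xs"

text \<open>Induction along the mapping cone: the \<open>True\<close> part \<open>a1\<close> of a
  cycle is a cycle for \<open>xs\<close>, and a primitive of \<open>- a1\<close> corrects the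
  \<open>False\<close> part to a cycle as well. The condition at the all-\<open>False\<close> list
  reflects that the homology at weight 0 is the quotient by the ideal of \<open>xs\<close>.\<close>

lemma koszul_exact:
  assumes "regular_sequence xs"
    and "\<And>bs. length bs = length xs \<Longrightarrow> koszul xs a bs = 0"
    and "a (replicate (length xs) False) \<in> ideal.span (set xs)"
  shows "\<exists>c. \<forall>bs. length bs = length xs \<longrightarrow> koszul xs c bs = a bs"
  using assms
proof (induction xs arbitrary: a)
  case Nil
  then show ?case
    by auto
next
  case (Cons x xs)
  define z where "z = replicate (length xs) False"
  define a0 where "a0 = (\<lambda>bs. a (False # bs))"
  define a1 where "a1 = (\<lambda>bs. a (True # bs))"
  have regular: "f \<in> ideal.span (set xs)" if "x * f \<in> ideal.span (set xs)" for f
    using Cons.prems(1) that by simp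
  have cycle0: "koszul xs a0 bs + x * a1 bs = 0" if "length bs = length xs" for bs
    using Cons.prems(2)[of "False # bs"] that by (simp add: a0_def a1_def)
  have cycle1: "koszul xs a1 bs = 0" if "length bs = length xs" for bs
    using Cons.prems(2)[of "True # bs"] that by (simp add: a1_def)
  \<comment> \<open>At weight 0 the cycle condition puts \<open>x * a1 z\<close> into the ideal of
    \<open>xs\<close>, and regularity cancels \<open>x\<close>.\<close>
  have "x * a1 z = - koszul xs a0 z"
    using cycle0[of z] by (simp add: z_def eq_neg_iff_add_eq_0 add.commute)
  then have "a1 z \<in> ideal.span (set xs)"
    using koszul_in_span[of z xs a0] by (metis regular ideal.span_neg length_replicate z_def)
  then obtain b' where b': "\<And>bs. length bs = length xs \<Longrightarrow> koszul xs b' bs = a1 bs"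
    using Cons.IH[of a1] Cons.prems(1) cycle1 unfolding z_def by auto
  have "a0 z \<in> ideal.span (insert x (set xs))"
    using Cons.prems(3) by (simp add: a0_def z_def)
  \<comment> \<open>This \<open>u\<close> becomes the value of \<open>b\<close> at \<open>z\<close>,
    which brings \<open>a0 - x * b\<close> into the ideal of \<open>xs\<close> there.\<close>
  then obtain u where u: "a0 z - u * x \<in> ideal.span (set xs)"
    by (auto simp: ideal.span_insert)
  \<comment> \<open>The coefficient at \<open>z\<close> does not affect the differential, so it can be chosen freely.\<close>
  define b where "b = (\<lambda>bs. if bs = z then u else - b' bs)"
  have b: "koszul xs b bs = - a1 bs" if "length bs = length xs" for bs
  proof -
    have "koszul xs b bs = koszul xs (\<lambda>bs. - 1 * b' bs) bs"
      by (rule koszul_cong) (use that in \<open>auto simp: b_def z_def weight_replicate\<close>)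
    then show ?thesis
      using b'[OF that] by (simp only: koszul_mult) simp
  qed
  define d where "d = (\<lambda>bs. a0 bs - x * b bs)"
  have "koszul xs d bs = 0" if "length bs = length xs" for bs
    using cycle0[OF that] b[OF that] by (simp add: d_def koszul_diff koszul_mult)
  moreover have "d z \<in> ideal.span (set xs)"
    using u by (simp add: d_def b_def mult.commute)
  ultimately obtain c where c: "\<And>bs. length bs = length xs \<Longrightarrow> koszul xs c bs = d bs"
    using Cons.IH[of d] Cons.prems(1) unfolding z_def by auto
  define e where "e = (\<lambda>bs. if hd bs then b (tl bs) else c (tl bs))"
  have "koszul (x # xs) e bs = a bs" if bs: "length bs = length (x # xs)" for bs
  proof -
    obtain y bs' where [simp]: "bs = y # bs'" "length bs' = length xs"
      using bs by (cases bs) auto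
    show ?thesis
      by (cases y) (simp_all add: e_def b c d_def a0_def a1_def)
  qed
  then show ?case
    by blast
qed

lemma koszul_all_True: "koszul xs a (replicate (length xs) True) = 0"
  by (induction xs arbitrary: a) simp_all

lemma regular_sequence_vars:
  assumes "distinct vs"
  shows "regular_sequence (map var vs)"
  using assms
proof (induction vs)
  case (Cons i vs)
  then show ?case
    by simp (metis var_regular)
qed simp

text \<open>A basis element of weight \<open>w\<close> carries degree \<open>w\<close>, so a
  coefficient of degree \<open>e - w\<close> has total degree \<open>e\<close>, which the
  differential preserves.\<close>

lemma koszul_homogeneous:
  fixes xs :: "('n::finite, 'k::field) mpoly list"
  assumes "\<And>bs. length bs = length xs \<Longrightarrow> homogeneous (e - int (weight bs)) (a bs)"
    and "\<And>x. x \<in> set xs \<Longrightarrow> homogeneous 1 x"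
    and "length bs = length xs"
  shows "homogeneous (e - int (weight bs)) (koszul xs a bs)"
proof -
  have "koszul xs a bs \<in> (\<lambda>w. {g. homogeneous (e - int w) g}) (weight bs)"
  proof (rule koszul_in[where G = "\<lambda>w. {g. homogeneous (e - int w) g}"])
    fix x f :: "('n, 'k) mpoly" and w
    assume "x \<in> set xs" "f \<in> {g. homogeneous (e - int (Suc w)) g}"
    then show "x * f \<in> {g. homogeneous (e - int w) g}"
      using homogeneous_mult[of 1 x "e - int (Suc w)" f] assms(2) by simp
  qed (use assms in \<open>auto simp: homogeneous_uminus homogeneous_add\<close>)
  then show ?thesis
    by simp
qed

text \<open>The differential lowers the weight by one, so the range of vanishing grows downwards by
  one weight.\<close>

lemma koszul_eq_0:
  assumes "\<And>bs. length bs = length xs \<Longrightarrow> m \<le> weight bs \<Longrightarrow> a bs = 0"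
    and "length bs = length xs" "m \<le> Suc (weight bs)"
  shows "koszul xs a bs = 0"
proof -
  have "koszul xs a bs \<in> (\<lambda>w. {g. m \<le> Suc w \<longrightarrow> g = 0}) (weight bs)"
    by (rule koszul_in[where G = "\<lambda>w. {g. m \<le> w \<longrightarrow> g = 0}"]) (use assms in auto)
  then show ?thesis
    using assms(3) by simp
qed

section \<open>The socle in high degrees\<close>

lemma koszul_diff_map:
  "koszul xs (\<lambda>c. diff_map F i (a c) k) bs = diff_map F i (\<lambda>l. koszul xs (\<lambda>c. a c l) bs) k"
  by (simp only: diff_map_def koszul_sum koszul_mult)

lemma koszul_aug_map:
  "koszul xs (\<lambda>c. aug_map F (a c)) bs = aug_map F (\<lambda>k. koszul xs (\<lambda>c. a c k) bs)"
  by (simp only: aug_map_def koszul_sum koszul_mult mult.commute[of _ "aug F _"])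

lemma diff_map_diff: "diff_map F i (\<lambda>k. v k - w k) k = diff_map F i v k - diff_map F i w k"
  by (simp add: diff_map_def right_diff_distrib sum_subtractf)

lemma aug_map_diff: "aug_map F (\<lambda>k. v k - w k) = aug_map F v - aug_map F w"
  by (simp add: aug_map_def left_diff_distrib sum_subtractf)

lemma diff_map_cong: "(\<And>l. l < rank F (Suc i) \<Longrightarrow> v l = w l) \<Longrightarrow> diff_map F i v k = diff_map F i w k"
  by (simp add: diff_map_def)

lemma aug_map_cong: "(\<And>k. k < rank F 0 \<Longrightarrow> v k = w k) \<Longrightarrow> aug_map F v = aug_map F w"
  by (simp add: aug_map_def)

text \<open>The maps of the resolution preserve degrees, so any lift may be replaced by its
  component of total degree \<open>e\<close>.\<close>

lemma homogeneous_diff_map_lift: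
  assumes F: "graded_free_resolution I F"
    and v: "\<And>k. k < rank F i \<Longrightarrow> homogeneous (e - shift F i k) (v k)"
    and w: "\<And>k. k < rank F i \<Longrightarrow> v k = diff_map F i w k"
  obtains w' where "\<And>l. l < rank F (Suc i) \<Longrightarrow> homogeneous (e - shift F (Suc i) l) (w' l)"
    and "\<And>k. k < rank F i \<Longrightarrow> v k = diff_map F i w' k"
proof
  let ?w = "\<lambda>l. component (e - shift F (Suc i) l) (w l)"
  show "homogeneous (e - shift F (Suc i) l) (?w l)" for l
    by (rule homogeneous_component)
  show "v k = diff_map F i ?w k" if k: "k < rank F i" for k
  proof -
    have "v k = component (e - shift F i k) (diff_map F i w k)"
      using component_homogeneous[OF v[OF k]] w[OF k] by simp
    also have "\<dots> = (\<Sum>l<rank F (Suc i). component (e - shift F i k) (mat F i k l * w l))"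
      by (simp add: diff_map_def component_sum)
    also have "\<dots> = diff_map F i ?w k"
      unfolding diff_map_def
    proof (rule sum.cong)
      fix l assume "l \<in> {..<rank F (Suc i)}"
      then have "homogeneous (shift F (Suc i) l - shift F i k) (mat F i k l)"
        using F k by (simp add: graded_free_resolution_def)
      then show "component (e - shift F i k) (mat F i k l * w l) = mat F i k l * ?w l"
        by (simp add: component_mult_left)
    qed simp
    finally show ?thesis .
  qed
qed

lemma homogeneous_aug_map_lift:
  assumes F: "graded_free_resolution I F" and g: "homogeneous e g" "g \<in> I"
  obtains v where "\<And>k. k < rank F 0 \<Longrightarrow> homogeneous (e - shift F 0 k) (v k)" "g = aug_map F v"
proof -
  obtain w where w: "g = aug_map F w"
    using F g by (auto simp: graded_free_resolution_def)
  let ?v = "\<lambda>k. component (e - shift F 0 k) (w k)"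
  have "g = component e (aug_map F w)"
    using component_homogeneous[OF g(1)] w by simp
  also have "\<dots> = (\<Sum>k<rank F 0. component e (w k * aug F k))"
    by (simp add: aug_map_def component_sum)
  also have "\<dots> = aug_map F ?v"
    unfolding aug_map_def
  proof (rule sum.cong)
    fix k assume "k \<in> {..<rank F 0}"
    then have "homogeneous (shift F 0 k) (aug F k)"
      using F by (simp add: graded_free_resolution_def)
    then show "component e (w k * aug F k) = ?v k * aug F k"
      by (rule component_mult_right)
  qed simp
  finally show ?thesis
    by (intro that[of ?v] homogeneous_component)
qed

lemma aug_map_diff_map:
  assumes "graded_free_resolution I F"
  shows "aug_map F (diff_map F 0 w) = 0"
  using assms unfolding graded_free_resolution_def by blast

lemma diff_map_diff_map:
  assumes "graded_free_resolution I F" "k < rank F i"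
  shows "diff_map F i (diff_map F (Suc i) w) k = 0"
  using assms unfolding graded_free_resolution_def by blast

text \<open>The two differentials commute, so the value is the Koszul differential applied twice to
  \<open>a\<close>. Exactness then lifts this cycle to the next module.\<close>

lemma koszul_cycle:
  assumes F: "graded_free_resolution I F"
    and a': "\<And>bs k. length bs = length xs \<Longrightarrow> k < rank F i \<Longrightarrow>
      koszul xs (\<lambda>c. a c k) bs = diff_map F i (a' bs) k"
    and k: "k < rank F i" and bs: "length bs = length xs"
  shows "diff_map F i (\<lambda>l. koszul xs (\<lambda>c. a' c l) bs) k = 0"
proof -
  have "diff_map F i (\<lambda>l. koszul xs (\<lambda>c. a' c l) bs) k = koszul xs (\<lambda>c. diff_map F i (a' c) k) bs"
    by (simp add: koszul_diff_map)
  also have "\<dots> = koszul xs (koszul xs (\<lambda>c. a c k)) bs"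
    by (rule koszul_cong) (simp_all add: a' k bs)
  finally show ?thesis
    by (simp add: koszul_koszul)
qed

text \<open>
  \<open>A i\<close> lifts the multiple \<open>f e_1 \<and> \<dots> \<and> e_n\<close> of the top Koszul basis element along the zigzag.
  The corrections found on the way back need not be homogeneous: minimality of the resolution keeps
  their images, hence the cycles to be bounded, inside the maximal ideal at \<open>weight 0\<close>.
\<close>

lemma socle_degree:
  fixes I :: "('n::finite, 'k::field) mpoly set"
  assumes I: "ideal.subspace I" and min: "minimal_graded_free_resolution I F"
    and shifts: "\<And>i k. k < rank F i \<Longrightarrow> shift F i k \<le> r + int i"
    and f: "homogeneous d f" "r \<le> d" "\<And>i. var i * f \<in> I"
  shows "f \<in> I"
proof -
  have F: "graded_free_resolution I F"
    using min by (simp add: minimal_graded_free_resolution_def)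
  define n where "n = card (UNIV :: 'n set)"
  have n: "0 < n"
    by (simp add: n_def card_gt_0_iff)
  obtain vs :: "'n list" where vs: "distinct vs" "set vs = UNIV"
    using finite_distinct_list[OF finite_UNIV] by blast
  define xs :: "('n, 'k) mpoly list" where "xs = map var vs"
  have length_xs: "length xs = n"
    using distinct_card[OF vs(1)] by (simp add: xs_def n_def vs)
  have regular: "regular_sequence xs"
    by (simp add: xs_def regular_sequence_vars vs)
  have span_xs: "ideal.span (set xs) = max_ideal"
    by (simp add: xs_def max_ideal_def vs)
  have xs_deg: "homogeneous 1 x" if "x \<in> set xs" for x
    using that by (auto simp: xs_def homogeneous_var)
  have xs_mult: "x * g \<in> I" if "x \<in> set xs" "\<forall>i. var i * g \<in> I" for x g
    using that by (auto simp: xs_def)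
  \<comment> \<open>The total degree of the multiple of the top basis element: \<open>d\<close> for
    \<open>f\<close> and 1 for each of the \<open>n\<close> variables.\<close>
  define e where "e = d + int n"
  define t where "t = (\<lambda>bs. if bs = replicate n True then f else 0)"

  have t_deg: "homogeneous (e - int (weight bs)) (t bs)" for bs
    using f(1) by (simp add: t_def e_def weight_replicate)
  have t_in: "koszul xs t bs \<in> I" if "length bs = n" for bs
  proof -
    have "koszul xs t bs \<in> (\<lambda>w::nat. I) (weight bs)"
    proof (rule koszul_in[where G = "\<lambda>w. {g. \<forall>i. var i * g \<in> I}"])
      fix bs'
      show "t bs' \<in> {g. \<forall>i. var i * g \<in> I}"
        using f(3) I by (simp add: t_def ideal.subspace_0)
    qed (use that I in \<open>auto simp: length_xs xs_mult ideal.subspace_0 ideal.subspace_add ideal.subspace_neg\<close>)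
    then show ?thesis .
  qed
  have t_eq_0: "koszul xs t bs = 0" if "length bs = n" "n \<le> weight bs" for bs
  proof (rule koszul_eq_0[where m = "Suc n"])
    fix bs' :: "bool list" assume "length bs' = length xs" "Suc n \<le> weight bs'"
    then show "t bs' = 0"
      using weight_le[of bs'] by (simp add: length_xs)
  qed (use that in \<open>simp_all add: length_xs\<close>)

  \<comment> \<open>\<open>P i a\<close>: \<open>a\<close> has total degree \<open>e\<close>, is
    supported in weights below \<open>n - i\<close>, and its Koszul differential lifts to the next
    module. \<open>Q i a a'\<close>: \<open>a'\<close> is such a lift.\<close>
  define P where "P = (\<lambda>i a. \<forall>bs. length bs = n \<longrightarrow>
    (\<forall>k<rank F i. homogeneous (e - int (weight bs) - shift F i k) (a bs k) \<and>
      (n \<le> weight bs + i \<longrightarrow> a bs k = 0)) \<and>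
    (\<exists>w. \<forall>k<rank F i. koszul xs (\<lambda>c. a c k) bs = diff_map F i w k))"
  define Q where "Q = (\<lambda>i a a'. \<forall>bs. length bs = n \<longrightarrow>
    (\<forall>k<rank F i. koszul xs (\<lambda>c. a c k) bs = diff_map F i (a' bs) k))"

  have "\<exists>v. length bs = n \<longrightarrow> koszul xs t bs = aug_map F v \<and>
      (\<forall>k<rank F 0. homogeneous (e - int (weight bs) - shift F 0 k) (v k) \<and>
        (n \<le> weight bs \<longrightarrow> v k = 0))" for bs
  proof (cases "length bs = n \<and> \<not> n \<le> weight bs")
    case True
    then have "homogeneous (e - int (weight bs)) (koszul xs t bs)"
      by (intro koszul_homogeneous) (auto simp: t_deg xs_deg length_xs)
    then obtain v where "\<And>k. k < rank F 0 \<Longrightarrow> homogeneous (e - int (weight bs) - shift F 0 k) (v k)"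
        "koszul xs t bs = aug_map F v"
      using homogeneous_aug_map_lift[OF F] t_in True by metis
    then show ?thesis
      using True by blast
  next
    case False
    then show ?thesis
      using t_eq_0 by (intro exI[of _ "\<lambda>_. 0"]) (auto simp: aug_map_def)
  qed
  then obtain a0 where a0: "\<And>bs. length bs = n \<Longrightarrow> koszul xs t bs = aug_map F (a0 bs) \<and>
      (\<forall>k<rank F 0. homogeneous (e - int (weight bs) - shift F 0 k) (a0 bs k) \<and>
        (n \<le> weight bs \<longrightarrow> a0 bs k = 0))"
    by metis

  have "P 0 a0"
  proof -
    \<comment> \<open>The Koszul differential squares to zero, so exactness at the module of index 0
      supplies the lift.\<close>
    have "\<exists>w. \<forall>k<rank F 0. koszul xs (\<lambda>c. a0 c k) bs = diff_map F 0 w k" if "length bs = n" for bs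
    proof -
      have "aug_map F (\<lambda>k. koszul xs (\<lambda>c. a0 c k) bs) = koszul xs (\<lambda>c. aug_map F (a0 c)) bs"
        by (simp add: koszul_aug_map)
      also have "\<dots> = koszul xs (koszul xs t) bs"
        by (rule koszul_cong) (simp_all add: a0 that length_xs)
      finally have "aug_map F (\<lambda>k. koszul xs (\<lambda>c. a0 c k) bs) = 0"
        by (simp add: koszul_koszul)
      moreover have "aug_map F v = 0 \<longleftrightarrow> (\<exists>w. \<forall>k<rank F 0. v k = diff_map F 0 w k)" for v
        using F by (simp add: graded_free_resolution_def)
      ultimately show ?thesis
        by simp
    qed
    then show ?thesis
      using a0 by (simp add: P_def)
  qed

  have step: "\<exists>a'. P (Suc i) a' \<and> Q i a a'" if Pa: "P i a" for i a
  proof -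
    have "\<exists>v. length bs = n \<longrightarrow> (\<forall>k<rank F i. koszul xs (\<lambda>c. a c k) bs = diff_map F i v k) \<and>
      (\<forall>l<rank F (Suc i). homogeneous (e - int (weight bs) - shift F (Suc i) l) (v l) \<and>
        (n \<le> weight bs + Suc i \<longrightarrow> v l = 0))" for bs
    proof (cases "length bs = n \<and> \<not> n \<le> weight bs + Suc i")
      case True
      have deg: "homogeneous (e - int (weight bs) - shift F i k) (koszul xs (\<lambda>c. a c k) bs)"
        if "k < rank F i" for k
      proof -
        have "homogeneous ((e - shift F i k) - int (weight bs)) (koszul xs (\<lambda>c. a c k) bs)"
          by (rule koszul_homogeneous)
            (use Pa True that in \<open>auto simp: P_def xs_deg length_xs algebra_simps\<close>)
        then show ?thesis
          by (simp add: algebra_simps)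
      qed
      obtain w where w: "\<And>k. k < rank F i \<Longrightarrow> koszul xs (\<lambda>c. a c k) bs = diff_map F i w k"
        using Pa True unfolding P_def by blast
      obtain v where "\<And>l. l < rank F (Suc i) \<Longrightarrow>
            homogeneous (e - int (weight bs) - shift F (Suc i) l) (v l)"
          "\<And>k. k < rank F i \<Longrightarrow> koszul xs (\<lambda>c. a c k) bs = diff_map F i v k"
        using homogeneous_diff_map_lift[OF F deg w] by metis
      then show ?thesis
        using True by blast
    next
      case False
      have "koszul xs (\<lambda>c. a c k) bs = 0"
        if "length bs = n" "n \<le> weight bs + Suc i" "k < rank F i" for k
        \<comment> \<open>The coefficients of \<open>a\<close> vanish from weight
          \<open>n - i\<close> on, so the differential vanishes already one weight lower, where zero
          can serve as the lift.\<close>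
        by (rule koszul_eq_0[where m = "n - i"])
          (use Pa that in \<open>auto simp: P_def length_xs\<close>)
      then show ?thesis
        using False by (intro exI[of _ "\<lambda>_. 0"]) (auto simp: diff_map_def)
    qed
    then obtain a' where a': "\<And>bs. length bs = n \<Longrightarrow>
      (\<forall>k<rank F i. koszul xs (\<lambda>c. a c k) bs = diff_map F i (a' bs) k) \<and>
      (\<forall>l<rank F (Suc i). homogeneous (e - int (weight bs) - shift F (Suc i) l) (a' bs l) \<and>
        (n \<le> weight bs + Suc i \<longrightarrow> a' bs l = 0))"
      by metis
    have "\<exists>w. \<forall>l<rank F (Suc i). koszul xs (\<lambda>c. a' c l) bs = diff_map F (Suc i) w l"
      if "length bs = n" for bs
    proof -
      have "\<forall>k<rank F i. diff_map F i (\<lambda>l. koszul xs (\<lambda>c. a' c l) bs) k = 0"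
        using koszul_cycle[OF F, of xs i a a'] a' that by (simp add: length_xs)
      moreover have "(\<forall>k<rank F i. diff_map F i v k = 0) \<longleftrightarrow>
          (\<exists>w. \<forall>l<rank F (Suc i). v l = diff_map F (Suc i) w l)" for v
        using F by (simp add: graded_free_resolution_def)
      ultimately show ?thesis
        by simp
    qed
    then have "P (Suc i) a'" "Q i a a'"
      using a' by (simp_all add: P_def Q_def)
    then show ?thesis
      by blast
  qed
  obtain A where A0: "A 0 = a0" and PA: "\<And>i. P i (A i)" and QA: "\<And>i. Q i (A i) (A (Suc i))"
  proof -
    have "\<exists>A. \<forall>i. (P i (A i) \<and> (i = 0 \<longrightarrow> A i = a0)) \<and> Q i (A i) (A (Suc i))"
      by (rule dependent_nat_choice) (use \<open>P 0 a0\<close> step in auto)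
    then show ?thesis
      using that by auto
  qed

  \<comment> \<open>Descending induction from \<open>n\<close>, where the support bound forces
    \<open>A n\<close> to vanish: each \<open>A i\<close> is a Koszul boundary up to an image of the
    next module. The primitive \<open>b\<close> found at \<open>Suc i\<close> is the correction at
    \<open>i\<close>.\<close>
  have "\<exists>b b'. \<forall>bs. length bs = n \<longrightarrow> (\<forall>k<rank F i.
      koszul xs (\<lambda>c. b c k) bs = A i bs k - diff_map F i (b' bs) k)" if "i \<le> n" for i
    using that
  proof (induction i rule: inc_induct)
    case base
    have "A n bs k = 0" if "length bs = n" "k < rank F n" for bs k
      using PA[of n] that by (simp add: P_def)
    then show ?case
      by (intro exI[of _ "\<lambda>_ _. 0"]) (simp add: koszul_zero diff_map_def)
  next
    case (step i)
    then obtain b b' where b: "\<And>bs k. length bs = n \<Longrightarrow> k < rank F (Suc i) \<Longrightarrow>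
        koszul xs (\<lambda>c. b c k) bs = A (Suc i) bs k - diff_map F (Suc i) (b' bs) k"
      by blast
    have "\<exists>c. k < rank F i \<longrightarrow> (\<forall>bs. length bs = n \<longrightarrow>
        koszul xs c bs = A i bs k - diff_map F i (b bs) k)" for k
    proof (cases "k < rank F i")
      case k: True
      define h where "h = (\<lambda>bs. A i bs k - diff_map F i (b bs) k)"
      \<comment> \<open>Both parts of \<open>h\<close> have the same Koszul differential:
        \<open>b\<close> is a primitive of \<open>A (Suc i)\<close> up to an image that
        \<open>diff_map F i\<close> kills.\<close>
      have "koszul xs h bs = 0" if bs: "length bs = n" for bs
      proof -
        have "koszul xs h bs = diff_map F i (A (Suc i) bs) k -
            diff_map F i (\<lambda>l. koszul xs (\<lambda>c. b c l) bs) k"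
          using QA[of i] bs k by (simp add: h_def koszul_diff koszul_diff_map Q_def)
        also have "diff_map F i (\<lambda>l. koszul xs (\<lambda>c. b c l) bs) k =
            diff_map F i (\<lambda>l. A (Suc i) bs l - diff_map F (Suc i) (b' bs) l) k"
          by (rule diff_map_cong) (simp add: b bs)
        also have "\<dots> = diff_map F i (A (Suc i) bs) k"
          using diff_map_diff_map[OF F k] by (simp add: diff_map_diff)
        finally show ?thesis
          by simp
      qed
      moreover have "h (replicate n False) \<in> max_ideal"
      proof -
        have "homogeneous (e - shift F i k) (A i (replicate n False) k)"
          using PA[of i] k by (auto simp: P_def weight_replicate dest: spec[of _ "replicate n False"])
        \<comment> \<open>The degree is at least \<open>n - i\<close> by the bound on the shifts and
          \<open>r \<le> d\<close>, and \<open>i < n\<close>.\<close>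
        then have "A i (replicate n False) k \<in> max_ideal"
          using shifts[OF k] f(2) step.hyps
          by (intro homogeneous_pos_in_max_ideal) (auto simp: e_def)
        moreover have "diff_map F i (b (replicate n False)) k \<in> max_ideal"
          unfolding diff_map_def max_ideal_def
        proof (rule ideal.span_sum)
          fix l assume "l \<in> {..<rank F (Suc i)}"
          then have "mat F i k l \<in> max_ideal"
            using min k by (simp add: minimal_graded_free_resolution_def)
          then show "mat F i k l * b (replicate n False) l \<in> ideal.span (range var)"
            unfolding max_ideal_def by (subst mult.commute) (rule ideal.span_scale)
        qed
        ultimately show ?thesis
          unfolding h_def max_ideal_def by (rule ideal.span_diff)
      qed
      ultimately have "\<exists>c. \<forall>bs. length bs = n \<longrightarrow> koszul xs c bs = h bs"
        using koszul_exact[OF regular, of h] by (simp add: length_xs span_xs)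
      then show ?thesis
        unfolding h_def by blast
    qed simp
    then obtain c where "\<And>k bs. k < rank F i \<Longrightarrow> length bs = n \<Longrightarrow>
        koszul xs (c k) bs = A i bs k - diff_map F i (b bs) k"
      by metis
    then show ?case
      by (intro exI[of _ "\<lambda>bs k. c k bs"] exI[of _ b]) simp
  qed
  from this[of 0] obtain b b' where b: "\<And>bs k. length bs = n \<Longrightarrow> k < rank F 0 \<Longrightarrow>
      koszul xs (\<lambda>c. b c k) bs = a0 bs k - diff_map F 0 (b' bs) k"
    using A0 by auto
  \<comment> \<open>The augmentation of the last primitive corrects \<open>t\<close> to a Koszul
    cycle over the polynomial ring.\<close>
  define s where "s = (\<lambda>c. t c - aug_map F (b c))"
  have s: "koszul xs s bs = 0" if bs: "length bs = n" for bs
  proof -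
    have "koszul xs s bs = aug_map F (a0 bs) - aug_map F (\<lambda>k. koszul xs (\<lambda>c. b c k) bs)"
      using a0[OF bs] by (simp add: s_def koszul_diff koszul_aug_map)
    also have "aug_map F (\<lambda>k. koszul xs (\<lambda>c. b c k) bs) =
        aug_map F (\<lambda>k. a0 bs k - diff_map F 0 (b' bs) k)"
      by (rule aug_map_cong) (simp add: b bs)
    also have "\<dots> = aug_map F (a0 bs)"
      using aug_map_diff_map[OF F] by (simp add: aug_map_diff)
    finally show ?thesis
      by simp
  qed
  obtain i xs' where xs': "xs = var i # xs'" "n = Suc (length xs')"
    using n length_xs by (cases vs) (auto simp: xs_def)
  \<comment> \<open>One weight below the top, the differential of \<open>s\<close> is the first
    variable times the top coefficient. So a cycle has zero top coefficient, which exhibits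
    \<open>f\<close> as an augmented element.\<close>
  have "var i * s (replicate n True) = 0"
    using s[of "False # replicate (length xs') True"]
    by (simp add: xs' koszul_all_True)
  then have "s (replicate n True) = 0"
    using var_mult_cancel[of i _ 0] by simp
  then have "f = aug_map F (b (replicate n True))"
    by (simp add: s_def t_def)
  then show ?thesis
    using F by (auto simp: graded_free_resolution_def)
qed

section \<open>Saturation\<close>

lemma subspace_colon:
  assumes "ideal.subspace I"
  shows "ideal.subspace {g. f * g \<in> I}"
proof (rule ideal.subspaceI)
  show "c * g \<in> {g. f * g \<in> I}" if "g \<in> {g. f * g \<in> I}" for c g
    using ideal.subspace_scale[OF assms, of "f * g" c] that by (simp only: mem_Collect_eq mult.left_commute)
qed (use assms in \<open>simp_all add: ideal.subspace_0 ideal.subspace_add distrib_left\<close>)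

lemma in_ideal_colon_span:
  assumes "ideal.subspace I"
  shows "f \<in> ideal_colon I (ideal.span G) \<longleftrightarrow> (\<forall>g\<in>G. f * g \<in> I)"
proof
  assume "\<forall>g\<in>G. f * g \<in> I"
  then have "ideal.span G \<subseteq> {g. f * g \<in> I}"
    by (intro ideal.span_minimal subspace_colon assms) auto
  then show "f \<in> ideal_colon I (ideal.span G)"
    by (auto simp: ideal_colon_def)
qed (auto simp: ideal_colon_def ideal.span_base)

text \<open>Peeling off one factor turns membership in the larger colon ideal into a socle condition
  on the multiples \<open>f * h\<close>.\<close>

lemma in_ideal_colon_power_Suc:
  assumes "ideal.subspace I"
  shows "f \<in> ideal_colon I (ideal_power J (Suc k)) \<longleftrightarrow>
    (\<forall>h\<in>ideal_power J k. f * h \<in> ideal_colon I J)"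
proof -
  have "f \<in> ideal_colon I (ideal_power J (Suc k)) \<longleftrightarrow>
      (\<forall>g\<in>J. \<forall>h\<in>ideal_power J k. f * (g * h) \<in> I)"
    unfolding ideal_power.simps ideal_mult_def in_ideal_colon_span[OF assms] by blast
  also have "\<dots> \<longleftrightarrow> (\<forall>h\<in>ideal_power J k. \<forall>g\<in>J. (f * h) * g \<in> I)"
    by (metis mult.assoc mult.commute)
  finally show ?thesis
    by (simp add: ideal_colon_def[of I J])
qed

lemma in_ideal_colon_max_ideal:
  "ideal.subspace I \<Longrightarrow> f \<in> ideal_colon I max_ideal \<longleftrightarrow> (\<forall>i. var i * f \<in> I)"
  by (simp add: max_ideal_def in_ideal_colon_span mult.commute)

lemma subspace_ideal_power: "ideal.subspace (ideal_power J k)"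
  by (cases k) (simp_all add: ideal_mult_def)

lemma ideal_power_Suc_subset: "ideal_power J (Suc k) \<subseteq> ideal_power J k"
proof -
  have "{f * g | f g. f \<in> J \<and> g \<in> ideal_power J k} \<subseteq> ideal_power J k"
    using ideal.subspace_scale[OF subspace_ideal_power] by blast
  then show ?thesis
    unfolding ideal_power.simps ideal_mult_def by (rule ideal.span_minimal) (rule subspace_ideal_power)
qed

section \<open>Degrees in powers of the maximal ideal\<close>

lemma subspace_mon_deg_ge: "ideal.subspace {f. \<forall>t\<in>Poly_Mapping.keys f. k \<le> mon_deg t}"
proof (rule ideal.subspaceI)
  fix f g :: "('a, 'b) mpoly"
  assume g: "g \<in> {f. \<forall>t\<in>Poly_Mapping.keys f. k \<le> mon_deg t}"
  show "f + g \<in> {f. \<forall>t\<in>Poly_Mapping.keys f. k \<le> mon_deg t}"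
    if "f \<in> {f. \<forall>t\<in>Poly_Mapping.keys f. k \<le> mon_deg t}"
    using g that Poly_Mapping.keys_add[of f g] by blast
  show "f * g \<in> {f. \<forall>t\<in>Poly_Mapping.keys f. k \<le> mon_deg t}"
    using g keys_mult[of f g] by (fastforce simp: mon_deg_add)
qed simp

lemma mon_deg_pos: "Poly_Mapping.lookup t i \<noteq> 0 \<Longrightarrow> 0 < mon_deg t"
  by (rule ccontr) (simp add: mon_deg_def)

lemma mon_deg_max_ideal_power:
  fixes h :: "('n::finite, 'k::field) mpoly"
  shows "h \<in> ideal_power max_ideal k \<Longrightarrow> t \<in> Poly_Mapping.keys h \<Longrightarrow> k \<le> mon_deg t"
proof (induction k arbitrary: h t)
  case (Suc k)
  have "{f * g | f g. f \<in> max_ideal \<and> g \<in> ideal_power max_ideal k} \<subseteq>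
      {f :: ('n, 'k) mpoly. \<forall>t\<in>Poly_Mapping.keys f. Suc k \<le> mon_deg t}"
  proof clarify
    fix f g :: "('n, 'k) mpoly" and t
    assume f: "f \<in> max_ideal" and g: "g \<in> ideal_power max_ideal k"
      and "t \<in> Poly_Mapping.keys (f * g)"
    then obtain u v where uv: "u \<in> Poly_Mapping.keys f" "v \<in> Poly_Mapping.keys g" "t = u + v"
      using keys_mult[of f g] by blast
    then have "0 < mon_deg u"
      using f by (auto simp: max_ideal_def span_vars intro: mon_deg_pos)
    then show "Suc k \<le> mon_deg t"
      using Suc.IH[OF g uv(2)] uv(3) by (simp add: mon_deg_add)
  qed
  then have "ideal_power max_ideal (Suc k) \<subseteq>
      {f :: ('n, 'k) mpoly. \<forall>t\<in>Poly_Mapping.keys f. Suc k \<le> mon_deg t}"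
    unfolding ideal_power.simps ideal_mult_def by (rule ideal.span_minimal) (rule subspace_mon_deg_ge)
  then show ?case
    using Suc.prems by blast
qed simp

text \<open>It is enough that the chain of colon ideals is stationary from \<open>r\<close> to
  \<open>r + 1\<close>. For \<open>h\<close> in the power \<open>r\<close>, all nonzero components
  of \<open>f * h\<close> have degree at least \<open>r\<close>, where \<open>socle\<close>
  applies.\<close>

lemma sat_number_le:
  fixes I :: "('n::finite, 'k::field) mpoly set"
  assumes I: "graded_ideal I"
    and socle: "\<And>d f. homogeneous d f \<Longrightarrow> int r \<le> d \<Longrightarrow> (\<And>i. var i * f \<in> I) \<Longrightarrow> f \<in> I"
  shows "sat_number I \<le> r"
  unfolding sat_number_def
proof (rule Least_le, rule subset_antisym)
  have sub: "ideal.subspace I"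
    using I by (simp add: graded_ideal_def)
  show "ideal_colon I (ideal_power max_ideal (r + 1)) \<subseteq> ideal_colon I (ideal_power max_ideal r)"
  proof
    fix f assume f: "f \<in> ideal_colon I (ideal_power max_ideal (r + 1))"
    have "f * h \<in> I" if h: "h \<in> ideal_power max_ideal r" for h
    proof -
      have fh: "f * h \<in> ideal_power max_ideal r"
        using ideal.subspace_scale[OF subspace_ideal_power h] .
      have var_in: "var i * (f * h) \<in> I" for i
        using f h by (simp add: in_ideal_colon_power_Suc[OF sub] in_ideal_colon_max_ideal[OF sub]
            del: ideal_power.simps)
      have "component d (f * h) \<in> I" if "d \<in> (\<lambda>t. int (mon_deg t)) ` Poly_Mapping.keys (f * h)" for d
      proof (rule socle[OF homogeneous_component])
        show "int r \<le> d"
          using that mon_deg_max_ideal_power[OF fh] by auto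
        \<comment> \<open>The component of degree \<open>d + 1\<close> of
          \<open>var i * (f * h)\<close> is \<open>var i\<close> times the component of degree
          \<open>d\<close> of \<open>f * h\<close>.\<close>
        show "var i * component d (f * h) \<in> I" for i
          using component_in_graded_ideal[OF I var_in, of "d + 1" i]
          unfolding component_mult_left[OF homogeneous_var] by simp
      qed
      then have "(\<Sum>d\<in>(\<lambda>t. int (mon_deg t)) ` Poly_Mapping.keys (f * h). component d (f * h)) \<in> I"
        by (rule ideal.subspace_sum[OF sub])
      then show ?thesis
        using sum_components[of "f * h"] by simp
    qed
    then show "f \<in> ideal_colon I (ideal_power max_ideal r)"
      by (simp add: ideal_colon_def)
  qed
  show "ideal_colon I (ideal_power max_ideal r) \<subseteq> ideal_colon I (ideal_power max_ideal (r + 1))"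
    using ideal_power_Suc_subset[of max_ideal r] by (auto simp: ideal_colon_def)
qed

theorem corollary1p4:
  fixes I :: "('n::finite, 'k::field) mpoly set"
  assumes "graded_ideal I"
  shows "ereal (real (sat_number I)) \<le> regularity I"
proof (cases "I = {0}")
  case True
  have "sat_number I \<le> 0"
  proof (rule sat_number_le[OF assms])
    fix f :: "('n, 'k) mpoly" and i :: 'n
    assume "\<And>i. var i * f \<in> I"
    then show "f \<in> I"
      using var_mult_cancel[of i f 0] True by simp
  qed
  then show ?thesis
    using True by (simp add: regularity_def)
next
  case False
  have sub: "ideal.subspace I"
    using assms by (simp add: graded_ideal_def)
  \<comment> \<open>The bound is shown for each minimal resolution separately, so it passes to the
    infimum.\<close>
  have "ereal (real (sat_number I)) \<le>
      (SUP (i, j)\<in>{(i, j). betti F i j \<noteq> 0}. ereal (real_of_int (j - int i)))" (is "_ \<le> ?S")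
    if F: "minimal_graded_free_resolution I F" for F
  proof (rule ccontr)
    assume less: "\<not> ?thesis"
    have le_S: "ereal (real_of_int (shift F i k - int i)) \<le> ?S" if "k < rank F i" for i k
    proof -
      have "betti F i (shift F i k) \<noteq> 0"
        using that by (auto simp: betti_def)
      then show ?thesis
        by (intro SUP_upper2[of "(i, shift F i k)"]) auto
    qed
    have shifts: "shift F i k < int (sat_number I) + int i" if "k < rank F i" for i k
    proof -
      have "ereal (real_of_int (shift F i k - int i)) < ereal (real (sat_number I))"
        using le_S[OF that] less by (meson le_less_trans not_le)
      then have "shift F i k - int i < int (sat_number I)"
        by (metis less_ereal.simps(1) of_int_less_iff of_int_of_nat_eq)
      then show ?thesis
        by simp
    qed
    \<comment> \<open>A nonzero generator has nonnegative degree. This makes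
      \<open>sat_number I\<close> positive, so that \<open>sat_number I - 1\<close> is a true
      predecessor.\<close>
    have "\<exists>k<rank F 0. aug F k \<noteq> 0"
    proof (rule ccontr)
      assume "\<not> ?thesis"
      then have "aug_map F = (\<lambda>v. 0)"
        by (intro ext) (simp add: aug_map_def)
      then show False
        using F False by (auto simp: minimal_graded_free_resolution_def graded_free_resolution_def)
    qed
    then obtain k where k: "k < rank F 0" "aug F k \<noteq> 0"
      by blast
    then have "0 \<le> shift F 0 k"
      using F by (auto simp: minimal_graded_free_resolution_def graded_free_resolution_def
          intro: homogeneous_nonneg)
    then have pos: "0 < sat_number I"
      using shifts[OF k(1)] by simp
    \<comment> \<open>The strict bounds on the integer shifts allow
      \<open>r = sat_number I - 1\<close> in \<open>socle_degree\<close>.\<close>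
    have "sat_number I \<le> sat_number I - 1"
    proof (rule sat_number_le[OF assms])
      fix d f
      assume f: "homogeneous d f" "int (sat_number I - 1) \<le> d" "\<And>i. var i * f \<in> I"
      have "shift F i k \<le> int (sat_number I - 1) + int i" if "k < rank F i" for i k
        using shifts[OF that] pos by linarith
      from socle_degree[OF sub F this f] show "f \<in> I" .
    qed
    then show False
      using pos by simp
  qed
  then have "(INF F\<in>{F. minimal_graded_free_resolution I F}.
      SUP (i, j)\<in>{(i, j). betti F i j \<noteq> 0}. ereal (real_of_int (j - int i))) \<ge> ereal (real (sat_number I))"
    by (intro INF_greatest) simp
  then show ?thesis
    using False by (simp add: regularity_def)
qed

end
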